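(* For every $\theta\in\Theta$ and $r>0$, the supremum $$C_r(\theta)=\sup_{w\in\mathcal P(\mathcal A_\infty)}\ \inf_{\lambda\in\operatorname{Alt}_r(\theta)}\int_{\mathcal A_\infty}\operatorname{KL}(P_a^\theta\|P_a^\lambda)\,w(\mathrm da)$$ is attained by some probability measure $w^\star\in\mathcal P(\mathcal A_\infty)$ supported on passive observation and the two endpoints of each intervention interval, i.e. on the finite set $\mathcal A=\{0\}\cup\{(j,U_{j,s}):j\in[p],\ s\in\{1,2\}\}$.
   Context: **Model.** Fix an integer $p\ge1$, $[p]=\{1,\dots,p\}$, intervals $[U_{j,1},U_{j,2}]$ ($j\in[p]$), and constants $\beta_{\min},A_{\max},\sigma_{\min},\sigma_{\max},C_{\max}>0$ with $\max_j\max_{u\in[U_{j,1},U_{j,2}]}|u|\le C_{\max}$. $\Theta$ is the set of all triples $\theta=(D,\mathbf A,\mathbf\Sigma)$ where $D$ is a directed acyclic graph (DAG) on $[p]$; $\mathbf A\in\mathbb R^{p\times p}$ satisfies $A_{jk}\ne0$ if and only if $k\to j$ is an edge of $D$, and $\beta_{\min}\le|A_{jk}|\le A_{\max}$ for every nonzero $A_{jk}$; and $\mathbf\Sigma=\operatorname{diag}(\sigma_1^2,\dots,\sigma_p^2)$ with $\sigma_{\min}^2\le\sigma_j^2\le\sigma_{\max}^2$. **Actions and distributions.** $\mathcal A_\infty=\{0\}\cup\{(j,u):j\in[p],u\in[U_{j,1},U_{j,2}]\}$ (with its Borel $\sigma$-algebra), where $0$ is passive observation and $(j,u)$ is the perfect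 intervention $\operatorname{do}(X_j=u)$. $P_0^\theta=\mathcal N(0,(\mathbf I-\mathbf A)^{-1}\mathbf\Sigma(\mathbf I-\mathbf A)^{-\mathsf T})$ on $\mathbb R^p$; for $a=(j,u)$ and $R=[p]\setminus\{j\}$, $P_a^\theta=\mathcal N\big((\mathbf I-\mathbf A_{R,R})^{-1}\mathbf A_{R,j}u,\ (\mathbf I-\mathbf A_{R,R})^{-1}\mathbf\Sigma_{R,R}(\mathbf I-\mathbf A_{R,R})^{-\mathsf T}\big)$ on $\mathbb R^{R}$. $\mathcal P(\mathcal A_\infty)$ is the set of probability measures on $\mathcal A_\infty$; $\operatorname{KL}$ is the Kullback–Leibler divergence. **Alternatives.** With $\|\mathbf M\|_{\max}=\max_{j,k}|M_{jk}|$, $\operatorname{Alt}_r(\theta)=\{\lambda\in\Theta: D^\lambda\ne D^\theta\text{ or }\|\mathbf A^\lambda-\mathbf A^\theta\|_{\max}\ge r\}$, where $\theta=(D^\theta,\mathbf A^\theta,\mathbf\Sigma^\theta)$ and $\lambda=(D^\lambda,\mathbf A^\lambda,\mathbf\Sigma^\lambda)$. *)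

theory Defs
  imports "HOL-Probability.Probability"
begin

text \<open>
  The index set is a finite type \<open>'p\<close> (so \<open>p = CARD('p)\<close>), and \<open>\<real>\<^sup>R\<close> for an index
  set \<open>R\<close> is the product space \<open>\<Pi>\<^sub>M i\<in>R. lborel\<close>, whose underlying measure is Lebesgue measure.
\<close>

section \<open>Normal distributions on coordinate subspaces\<close>

text \<open>
  The submatrix \<open>M\<^sub>R\<^sub>R\<close>, padded to a full matrix by the identity: up to a simultaneous permutation
  of rows and columns, \<open>block R M\<close> is the block diagonal matrix with blocks \<open>M\<^sub>R\<^sub>R\<close> and \<open>I\<close>.
  Hence \<open>det (block R M)\<close> is \<open>det M\<^sub>R\<^sub>R\<close>, the \<open>R\<times>R\<close> block of \<open>matrix_inv (block R M)\<close> is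
  \<open>(M\<^sub>R\<^sub>R)\<^sup>-\<^sup>1\<close> if that exists, and products and transposes are formed blockwise.
\<close>

definition block :: "'p set \<Rightarrow> real^'p^'p \<Rightarrow> real^'p^'p" where
  "block R M = (\<chi> i k. if i \<in> R \<and> k \<in> R then M $ i $ k else if i = k then 1 else 0)"

text \<open>
  The normal distribution on \<open>\<real>\<^sup>R\<close> with mean \<open>\<mu>\<^sub>R\<close> and positive definite covariance matrix
  \<open>S\<^sub>R\<^sub>R\<close>, by its Lebesgue density. Entries of \<open>\<mu>\<close> and \<open>S\<close> with an index outside \<open>R\<close> are ignored.
\<close>

definition mvn :: "'p::finite set \<Rightarrow> real^'p \<Rightarrow> real^'p^'p \<Rightarrow> ('p \<Rightarrow> real) measure" where
  "mvn R \<mu> S = density (\<Pi>\<^sub>M i\<in>R. lborel) (\<lambda>x. ennreal (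
     exp (- (\<Sum>i\<in>R. \<Sum>k\<in>R. (x i - \<mu> $ i) * matrix_inv (block R S) $ i $ k * (x k - \<mu> $ k)) / 2)
     / sqrt ((2 * pi) ^ card R * det (block R S))))"

section \<open>The model\<close>

record 'p model =
  dag :: "('p \<times> 'p) set"
  coef :: "real^'p^'p"
  noise :: "real^'p^'p"

definition models :: "real \<Rightarrow> real \<Rightarrow> real \<Rightarrow> real \<Rightarrow> ('p::finite) model set" where
  "models \<beta>min Amax \<sigma>min \<sigma>max = {\<theta>.
     acyclic (dag \<theta>) \<and>
     (\<forall>j k. coef \<theta> $ j $ k \<noteq> 0 \<longleftrightarrow> (k, j) \<in> dag \<theta>) \<and>
     (\<forall>j k. coef \<theta> $ j $ k \<noteq> 0 \<longrightarrow> \<beta>min \<le> \<bar>coef \<theta> $ j $ k\<bar> \<and> \<bar>coef \<theta> $ j $ k\<bar> \<le> Amax) \<and>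
     (\<exists>\<sigma> :: 'p \<Rightarrow> real.
        noise \<theta> = (\<chi> j k. if j = k then (\<sigma> j)\<^sup>2 else 0) \<and>
        (\<forall>j. \<sigma>min\<^sup>2 \<le> (\<sigma> j)\<^sup>2 \<and> (\<sigma> j)\<^sup>2 \<le> \<sigma>max\<^sup>2))}"

definition max_norm :: "real^'p^'p \<Rightarrow> real" where
  "max_norm M = Max {\<bar>M $ j $ k\<bar> | j k. True}"

definition Alt :: "real \<Rightarrow> real \<Rightarrow> real \<Rightarrow> real \<Rightarrow> real \<Rightarrow> ('p::finite) model \<Rightarrow> 'p model set" where
  "Alt \<beta>min Amax \<sigma>min \<sigma>max r \<theta> = {\<kappa> \<in> models \<beta>min Amax \<sigma>min \<sigma>max.
     dag \<kappa> \<noteq> dag \<theta> \<or> max_norm (coef \<kappa> - coef \<theta>) \<ge> r}"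

section \<open>Actions\<close>

datatype 'p action = Obs | Do 'p real

definition actions :: "('p \<Rightarrow> real) \<Rightarrow> ('p \<Rightarrow> real) \<Rightarrow> 'p action set" where
  "actions U1 U2 = insert Obs {Do j u | j u. u \<in> {U1 j..U2 j}}"

definition endpoint_actions :: "('p \<Rightarrow> real) \<Rightarrow> ('p \<Rightarrow> real) \<Rightarrow> 'p action set" where
  "endpoint_actions U1 U2 = insert Obs (range (\<lambda>j. Do j (U1 j)) \<union> range (\<lambda>j. Do j (U2 j)))"

text \<open>
  The Borel space of \<open>actions U1 U2\<close>, topologised as the disjoint union of a point and the
  intervals.
\<close>

definition action_space :: "('p \<Rightarrow> real) \<Rightarrow> ('p \<Rightarrow> real) \<Rightarrow> 'p action measure" where
  "action_space U1 U2 = sigma (actions U1 U2)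
     {S. S \<subseteq> actions U1 U2 \<and> (\<forall>j. openin (top_of_set {U1 j..U2 j}) {u. Do j u \<in> S})}"

definition designs :: "('p \<Rightarrow> real) \<Rightarrow> ('p \<Rightarrow> real) \<Rightarrow> 'p action measure set" where
  "designs U1 U2 = {w. prob_space w \<and> sets w = sets (action_space U1 U2)}"

text \<open>
  \<open>Do j u\<close> is the perfect intervention \<open>do(X\<^sub>j = u)\<close>; \<open>K\<close> is \<open>(I - A\<^sub>R\<^sub>R)\<^sup>-\<^sup>1\<close>, padded at \<open>j\<close>, and the
  entries of mean and covariance at \<open>j\<close> play no role.
\<close>

fun act_dist :: "('p::finite) model \<Rightarrow> 'p action \<Rightarrow> ('p \<Rightarrow> real) measure" where
  "act_dist \<theta> Obs =
     (let K = matrix_inv (mat 1 - coef \<theta>)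
      in mvn UNIV 0 (K ** noise \<theta> ** transpose K))"
| "act_dist \<theta> (Do j u) =
     (let R = UNIV - {j}; K = matrix_inv (block R (mat 1 - coef \<theta>))
      in mvn R (K *v (u *\<^sub>R column j (coef \<theta>))) (K ** block R (noise \<theta>) ** transpose K))"

section \<open>The objective\<close>

text \<open>
  The library's \<open>KL_divergence\<close> takes the reference measure first. It is a real-valued integral,
  which is the Kullback-Leibler divergence whenever the latter is finite; this is the case for
  any two nondegenerate normal distributions on the same \<open>\<real>\<^sup>R\<close>. Its value is nonnegative, so the
  coercion to \<^typ>\<open>ennreal\<close> below is faithful.
\<close>

definition KL :: "'a measure \<Rightarrow> 'a measure \<Rightarrow> real" where
  "KL P Q = KL_divergence (exp 1) Q P"

text \<open>
  Values are taken in \<^typ>\<open>ennreal\<close>, so that the infimum over an empty set of alternatives is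
  \<open>\<infinity>\<close>.
\<close>

definition worst_case ::
    "real \<Rightarrow> real \<Rightarrow> real \<Rightarrow> real \<Rightarrow> real \<Rightarrow> ('p::finite) model \<Rightarrow> 'p action measure \<Rightarrow> ennreal" where
  "worst_case \<beta>min Amax \<sigma>min \<sigma>max r \<theta> w =
     (INF \<kappa> \<in> Alt \<beta>min Amax \<sigma>min \<sigma>max r \<theta>.
        \<integral>\<^sup>+ a. ennreal (KL (act_dist \<theta> a) (act_dist \<kappa> a)) \<partial>w)"

definition C_opt ::
    "('p \<Rightarrow> real) \<Rightarrow> ('p \<Rightarrow> real) \<Rightarrow> real \<Rightarrow> real \<Rightarrow> real \<Rightarrow> real \<Rightarrow> real \<Rightarrow> ('p::finite) model \<Rightarrow> ennreal" where
  "C_opt U1 U2 \<beta>min Amax \<sigma>min \<sigma>max r \<theta> =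
     (SUP w \<in> designs U1 U2. worst_case \<beta>min Amax \<sigma>min \<sigma>max r \<theta> w)"

end

theory Submission
  imports Defs
begin

text \<open>
  The law under \<open>do(X\<^sub>j = u)\<close> is a normal law whose mean is linear in \<open>u\<close> and whose covariance does
  not depend on \<open>u\<close>, so \<open>KL(P\<^sup>\<theta>\<^sub>a, P\<^sup>\<kappa>\<^sub>a)\<close> has the form \<open>c + q u\<^sup>2\<close> with \<open>q \<ge> 0\<close>. Moving all mass that a design
  puts on interventions at \<open>j\<close> to the endpoint of larger modulus therefore increases the information
  against every alternative at once. This leaves one action per arm, that is a compact simplex of
  designs, on which the objective is an infimum of linear functions and hence upper semicontinuous.
\<close>

section \<open>Positive definite matrices\<close>

text \<open>The notion concerns the quadratic form alone, without symmetry; invertibility, a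
  positive determinant and coercivity already follow from it.\<close>

definition pos_def :: "real^'n^'n \<Rightarrow> bool" where
  "pos_def M \<longleftrightarrow> (\<forall>x. x \<noteq> 0 \<longrightarrow> 0 < x \<bullet> (M *v x))"

lemma matrix_inv_eq_mat:
  fixes M :: "real^'n^'n"
  assumes "invertible M"
  shows "M ** matrix_inv M = mat 1" "matrix_inv M ** M = mat 1"
  using someI_ex[OF assms[unfolded invertible_def]] by (auto simp: matrix_inv_def)

lemma invertible_iff_ker:
  fixes M :: "real^'n^'n"
  shows "invertible M \<longleftrightarrow> (\<forall>x. M *v x = 0 \<longrightarrow> x = 0)"
  by (simp add: invertible_left_inverse matrix_left_invertible_ker)

lemma pos_def_invertible: "pos_def M \<Longrightarrow> invertible M"
  unfolding invertible_iff_ker pos_def_def by (metis inner_zero_right less_irrefl)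

text \<open>Substituting \<open>x = M *v y\<close> turns the form of the inverse at \<open>x\<close>
  into the form of \<open>M\<close> at \<open>y\<close>.\<close>

lemma pos_def_matrix_inv:
  assumes "pos_def M"
  shows "pos_def (matrix_inv M)"
  unfolding pos_def_def
proof safe
  fix x :: "real^'a" assume "x \<noteq> 0"
  define y where "y = matrix_inv M *v x"
  have x: "x = M *v y"
    using matrix_inv_eq_mat[OF pos_def_invertible[OF assms]]
    by (simp add: y_def matrix_vector_mul_assoc)
  with \<open>x \<noteq> 0\<close> have "y \<noteq> 0" by auto
  then have "0 < x \<bullet> y"
    using assms x by (simp add: pos_def_def inner_commute)
  then show "0 < x \<bullet> (matrix_inv M *v x)"
    by (simp add: y_def)
qed

text \<open>The segment from the identity to \<open>M\<close> consists of positive definite, hence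
  invertible, matrices. The determinant is 1 at one end and has no zero on the way, so it stays
  positive. This makes the normalising constants of the densities positive.\<close>

lemma pos_def_det_pos:
  fixes M :: "real^'n^'n"
  assumes "pos_def M"
  shows "0 < det M"
proof (rule ccontr)
  assume "\<not> 0 < det M"
  define N where "N t = (1 - t) *\<^sub>R mat 1 + t *\<^sub>R M" for t
  have "continuous_on {0..1} (\<lambda>t. det (N t))"
    unfolding det_def N_def by (intro continuous_intros)
  then obtain t where t: "0 \<le> t" "t \<le> 1" "det (N t) = 0"
    using IVT2'[of "\<lambda>t. det (N t)" 1 0 0] \<open>\<not> 0 < det M\<close> by (auto simp: N_def)
  have "pos_def (N t)"
    unfolding pos_def_def
  proof safe
    fix x :: "real^'n" assume "x \<noteq> 0"
    then have "0 < x \<bullet> x" "0 < x \<bullet> (M *v x)"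
      using assms by (auto simp: pos_def_def)
    moreover have "x \<bullet> (N t *v x) = (1 - t) * (x \<bullet> x) + t * (x \<bullet> (M *v x))"
      by (simp add: N_def matrix_vector_mult_add_rdistrib scaleR_matrix_vector_assoc[symmetric]
          inner_add_right)
    ultimately show "0 < x \<bullet> (N t *v x)"
      using t by (cases "t = 0") (auto intro!: add_nonneg_pos)
  qed
  then show False
    using t pos_def_invertible invertible_det_nz by blast
qed

text \<open>The form attains a positive minimum on the compact unit sphere, and homogeneity of
  degree two carries it to all vectors.\<close>

lemma pos_def_lower_bound:
  fixes M :: "real^'n^'n"
  assumes "pos_def M"
  obtains c where "0 < c" "\<And>x. c * (norm x)\<^sup>2 \<le> x \<bullet> (M *v x)"
proof -
  have "continuous_on (sphere 0 1) (\<lambda>x. x \<bullet> (M *v x))"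
    by (intro continuous_intros linear_continuous_on linear_linear[THEN iffD2] matrix_vector_mul_linear)
  moreover have "sphere (0::real^'n) 1 \<noteq> {}"
    using norm_axis_1 by (metis dist_0_norm empty_iff mem_sphere)
  ultimately obtain z where z: "norm z = 1"
    "\<And>y. norm y = 1 \<Longrightarrow> z \<bullet> (M *v z) \<le> y \<bullet> (M *v y)"
    using continuous_attains_inf[of "sphere (0::real^'n) 1" "\<lambda>x. x \<bullet> (M *v x)"] by auto
  show ?thesis
  proof
    show "0 < z \<bullet> (M *v z)"
      using z(1) assms unfolding pos_def_def by (metis norm_zero zero_neq_one)
    fix x :: "real^'n"
    show "z \<bullet> (M *v z) * (norm x)\<^sup>2 \<le> x \<bullet> (M *v x)"
    proof (cases "x = 0")
      case False
      define y where "y = (1 / norm x) *\<^sub>R x"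
      have "norm y = 1" and x: "x = norm x *\<^sub>R y"
        using False by (auto simp: y_def)
      have "x \<bullet> (M *v x) = (norm x)\<^sup>2 * (y \<bullet> (M *v y))"
        by (subst (1 2) x) (simp add: matrix_vector_mult_scaleR power2_eq_square)
      then show ?thesis
        using z(2)[OF \<open>norm y = 1\<close>] by (simp add: mult.commute mult_right_mono)
    qed simp
  qed
qed

text \<open>The form at \<open>x\<close> is the form of \<open>D\<close> at
  \<open>transpose K *v x\<close>, which is nonzero. The covariances of the model have this
  shape.\<close>

lemma pos_def_congruence:
  fixes K D :: "real^'n^'n"
  assumes "pos_def D" "invertible K"
  shows "pos_def (K ** D ** transpose K)"
  unfolding pos_def_def
proof safe
  fix x :: "real^'n" assume "x \<noteq> 0"
  have "transpose K *v x \<noteq> 0"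
    using assms(2) \<open>x \<noteq> 0\<close> invertible_iff_ker transpose_invertible by blast
  then show "0 < x \<bullet> ((K ** D ** transpose K) *v x)"
    using assms(1) 
    by (simp add: pos_def_def matrix_vector_mul_assoc[symmetric] dot_lmul_matrix[symmetric])
qed

section \<open>Zero-padded vectors and identity-padded blocks\<close>

definition restr_vec :: "'p::finite set \<Rightarrow> ('p \<Rightarrow> real) \<Rightarrow> real^'p" where
  "restr_vec R x = (\<chi> i. if i \<in> R then x i else 0)"

lemma restr_vec_nth [simp]: "restr_vec R x $ i = (if i \<in> R then x i else 0)"
  by (simp add: restr_vec_def)

text \<open>Points of the product space over \<open>R\<close> become vectors of the full space, so
  the double sum in the exponent of \<open>mvn\<close> can be treated by matrix algebra and
  norms.\<close>

lemma inner_restr_vec: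
  "restr_vec R x \<bullet> (M *v restr_vec R y) = (\<Sum>i\<in>R. \<Sum>k\<in>R. x i * M $ i $ k * y k)"
proof -
  have "restr_vec R x \<bullet> (M *v restr_vec R y)
      = (\<Sum>i\<in>UNIV. (if i \<in> R then x i * (\<Sum>k\<in>UNIV. if k \<in> R then M $ i $ k * y k else 0) else 0))"
    by (auto simp: inner_vec_def matrix_vector_mult_def if_distrib cong: if_cong intro!: sum.cong)
  also have "\<dots> = (\<Sum>i\<in>R. x i * (\<Sum>k\<in>R. M $ i $ k * y k))"
    by (simp add: sum.If_cases)
  finally show ?thesis by (simp add: sum_distrib_left mult_ac)
qed

lemma block_mult_vec:
  "(block R M *v x) $ i = (if i \<in> R then \<Sum>k\<in>R. M $ i $ k * x $ k else x $ i)"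
proof (cases "i \<in> R")
  case True
  then have "(block R M *v x) $ i = (\<Sum>k\<in>UNIV. if k \<in> R then M $ i $ k * x $ k else 0)"
    by (auto simp: matrix_vector_mult_def block_def intro!: sum.cong)
  with True show ?thesis by (simp add: sum.If_cases)
next
  case False
  then have "(block R M *v x) $ i = (\<Sum>k\<in>UNIV. if k = i then x $ k else 0)"
    unfolding matrix_vector_mult_def block_def vec_lambda_beta by (intro sum.cong) auto
  with False show ?thesis by simp
qed

text \<open>The form of the padded block splits into the form of \<open>M\<close> at the restriction
  of \<open>x\<close> to \<open>R\<close> and the sum of squares of the remaining coordinates; a
  nonzero \<open>x\<close> makes at least one of the two positive.\<close>

lemma pos_def_block:
  fixes M :: "real^'n^'n"
  assumes "pos_def M"
  shows "pos_def (block R M)"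
  unfolding pos_def_def
proof safe
  fix x :: "real^'n" assume "x \<noteq> 0"
  let ?y = "restr_vec R (($) x)"
  have "x \<bullet> (block R M *v x)
      = (\<Sum>i\<in>UNIV. if i \<in> R then x $ i * (\<Sum>k\<in>R. M $ i $ k * x $ k) else (x $ i)\<^sup>2)"
    by (auto simp: inner_vec_def block_mult_vec power2_eq_square intro!: sum.cong)
  also have "\<dots> = ?y \<bullet> (M *v ?y) + (\<Sum>i\<in>-R. (x $ i)\<^sup>2)"
    by (simp add: sum.If_cases inner_restr_vec sum_distrib_left mult_ac)
  also have "\<dots> > 0"
  proof (cases "?y = 0")
    case True
    then have "\<And>i. i \<in> R \<Longrightarrow> x $ i = 0"
      by (metis restr_vec_nth zero_index)
    with \<open>x \<noteq> 0\<close> obtain i where "i \<in> -R" "x $ i \<noteq> 0"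
      by (auto simp: vec_eq_iff)
    then have "0 < (\<Sum>i\<in>-R. (x $ i)\<^sup>2)"
      by (intro sum_pos2[of _ i]) auto
    with True show ?thesis by simp
  next
    case False
    then show ?thesis
      using assms by (auto simp: pos_def_def intro!: add_pos_nonneg sum_nonneg)
  qed
  finally show "0 < x \<bullet> (block R M *v x)" .
qed

lemma pos_def_diag:
  assumes "\<And>i. 0 < d i"
  shows "pos_def (\<chi> i k. if i = k then d i else (0::real))"
  unfolding pos_def_def
proof safe
  fix x :: "real^'a" assume "x \<noteq> 0"
  then obtain i where "x $ i \<noteq> 0" by (auto simp: vec_eq_iff)
  then have "0 < (\<Sum>i\<in>UNIV. d i * (x $ i)\<^sup>2)"
    using assms by (intro sum_pos2[of _ i]) (auto intro!: mult_nonneg_nonneg intro: less_imp_le)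
  also have "\<dots> = x \<bullet> ((\<chi> i k. if i = k then d i else 0) *v x)"
  proof -
    have "((\<chi> i k. if i = k then d i else 0) *v x) $ i = (\<Sum>k\<in>UNIV. if i = k then d k * x $ k else 0)" for i
      unfolding matrix_vector_mult_def vec_lambda_beta by (intro sum.cong) auto
    then show ?thesis
      by (simp add: inner_vec_def power2_eq_square mult_ac)
  qed
  finally show "0 < x \<bullet> ((\<chi> i k. if i = k then d i else 0) *v x)" .
qed

text \<open>
  A kernel vector of \<open>I - A\<close> vanishes at a vertex as soon as it vanishes at all parents.
\<close>

lemma invertible_block_dag:
  fixes A :: "real^'n^'n"
  assumes "acyclic E" "\<And>j k. A $ j $ k \<noteq> 0 \<Longrightarrow> (k, j) \<in> E"
  shows "invertible (block R (mat 1 - A))"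
  unfolding invertible_iff_ker
proof safe
  fix x :: "real^'n" assume x: "block R (mat 1 - A) *v x = 0"
  have "wf E" using assms(1) by (simp add: finite_acyclic_wf)
  have "x $ j = 0" for j
  proof (induction j rule: wf_induct_rule[OF \<open>wf E\<close>])
    case (1 j)
    show ?case
    proof (cases "j \<in> R")
      case True
      have "0 = (\<Sum>k\<in>R. (mat 1 - A) $ j $ k * x $ k)"
        using x True by (metis block_mult_vec zero_index)
      also have "\<dots> = (\<Sum>k\<in>R. if k = j then x $ k else 0) - (\<Sum>k\<in>R. A $ j $ k * x $ k)"
        unfolding sum_subtractf[symmetric]
        by (intro sum.cong) (auto simp: mat_def algebra_simps)
      also have "(\<Sum>k\<in>R. A $ j $ k * x $ k) = 0"
        using 1 assms(2) by (intro sum.neutral) fastforce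
      finally show ?thesis using True by simp
    next
      case False
      with x show ?thesis by (metis block_mult_vec zero_index)
    qed
  qed
  then show "x = 0" by (simp add: vec_eq_iff)
qed

lemma invertible_matrix_inv:
  fixes M :: "real^'n^'n"
  assumes "invertible M"
  shows "invertible (matrix_inv M)"
  using matrix_inv_eq_mat[OF assms] by (auto simp: invertible_def)

section \<open>Gaussian integrals\<close>

text \<open>The integrand is a multiple of the centred normal density with variance
  \<open>1 / (2 * c)\<close>.\<close>

lemma integrable_exp_minus_square:
  assumes "0 < (c::real)"
  shows "integrable lborel (\<lambda>x::real. exp (- (c * x\<^sup>2)))"
proof -
  define s where "s = sqrt (1 / (2 * c))"
  have s: "0 < s" "s\<^sup>2 = 1 / (2 * c)" using assms by (auto simp: s_def)
  have "integrable lborel (\<lambda>x. sqrt (2 * pi * s\<^sup>2) * normal_density 0 s x)"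
    using s by (intro integrable_mult_right) auto
  also have "(\<lambda>x. sqrt (2 * pi * s\<^sup>2) * normal_density 0 s x) = (\<lambda>x. exp (- (c * x\<^sup>2)))"
    using assms s by (auto simp: normal_density_def real_sqrt_mult field_simps)
  finally show ?thesis .
qed

lemma measurable_restr_vec [measurable]:
  fixes R :: "'p::finite set"
  shows "restr_vec R \<in> borel_measurable (\<Pi>\<^sub>M i\<in>R. lborel)"
proof -
  have "(\<lambda>x. restr_vec R x $ i) \<in> borel_measurable (\<Pi>\<^sub>M i\<in>R. lborel)" for i
    by (cases "i \<in> R") auto
  then show ?thesis
    by (subst borel_measurable_euclidean_space) (auto simp: Basis_vec_def inner_axis)
qed

interpretation lborel_PiM: product_sigma_finite "\<lambda>_::'p. lborel :: real measure" ..

text \<open>Coercivity bounds the Gaussian factor by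
  \<open>exp (- (c / 2 * (norm v)\<^sup>2))\<close>. Half of this decay absorbs the quadratic growth
  of \<open>h\<close>; the other half is a product of one-dimensional integrable functions.\<close>

lemma integrable_PiM_gaussian:
  fixes R :: "'p::finite set" and h :: "real^'p \<Rightarrow> real"
  assumes Q: "pos_def Q" and [measurable]: "h \<in> borel_measurable borel"
    and h: "\<And>v. \<bar>h v\<bar> \<le> C * (1 + (norm v)\<^sup>2)"
  shows "integrable (\<Pi>\<^sub>M i\<in>R. lborel)
    (\<lambda>x. exp (- (restr_vec R x \<bullet> (Q *v restr_vec R x)) / 2) * h (restr_vec R x))"
proof -
  obtain c where c: "0 < c" "\<And>v. c * (norm v)\<^sup>2 \<le> v \<bullet> (Q *v v)"
    using pos_def_lower_bound[OF Q] by auto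
  \<comment> \<open>This choice gives \<open>1 \<le> B\<close> and
    \<open>1 \<le> B * (c / 4)\<close>, hence \<open>1 + s \<le> B * (1 + c / 4 * s)\<close> for
    \<open>s \<ge> 0\<close>, and the right-hand side is at most
    \<open>B * exp (c / 4 * s)\<close>.\<close>
  define B where "B = max 1 (4 / c)"
  have [measurable]: "(\<lambda>v. v \<bullet> (Q *v v)) \<in> borel_measurable borel"
    by (intro borel_measurable_continuous_onI continuous_intros linear_continuous_on
        linear_linear[THEN iffD2] matrix_vector_mul_linear)
  have bound: "exp (- (v \<bullet> (Q *v v)) / 2) * \<bar>h v\<bar> \<le> \<bar>C\<bar> * B * exp (- (c / 4 * (norm v)\<^sup>2))" for v
  proof -
    have "1 + (norm v)\<^sup>2 \<le> B * (1 + c / 4 * (norm v)\<^sup>2)"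
    proof -
      have "1 \<le> B" "1 \<le> B * (c / 4)" using c by (auto simp: B_def max_def field_simps)
      then have "1 * 1 + 1 * (norm v)\<^sup>2 \<le> B * 1 + B * (c / 4) * (norm v)\<^sup>2"
        by (intro add_mono mult_right_mono) auto
      then show ?thesis by (simp add: algebra_simps)
    qed
    also have "\<dots> \<le> B * exp (c / 4 * (norm v)\<^sup>2)"
      by (intro mult_left_mono exp_ge_add_one_self) (auto simp: B_def)
    finally have *: "1 + (norm v)\<^sup>2 \<le> B * exp (c / 4 * (norm v)\<^sup>2)" .
    have "\<bar>h v\<bar> \<le> \<bar>C\<bar> * (1 + (norm v)\<^sup>2)"
      using h[of v] by (rule order_trans) (auto intro!: mult_right_mono)
    also have "\<dots> \<le> \<bar>C\<bar> * (B * exp (c / 4 * (norm v)\<^sup>2))"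
      using * by (intro mult_left_mono) auto
    finally have "exp (- (v \<bullet> (Q *v v)) / 2) * \<bar>h v\<bar>
        \<le> exp (- (c / 2 * (norm v)\<^sup>2)) * (\<bar>C\<bar> * (B * exp (c / 4 * (norm v)\<^sup>2)))"
      using c(2)[of v] by (intro mult_mono) auto
    also have "\<dots> = \<bar>C\<bar> * B * (exp (- (c / 2 * (norm v)\<^sup>2)) * exp (c / 4 * (norm v)\<^sup>2))"
      by simp
    also have "exp (- (c / 2 * (norm v)\<^sup>2)) * exp (c / 4 * (norm v)\<^sup>2) = exp (- (c / 4 * (norm v)\<^sup>2))"
      by (simp add: exp_add[symmetric])
    finally show ?thesis .
  qed
  have "integrable (\<Pi>\<^sub>M i\<in>R. lborel) (\<lambda>x. \<bar>C\<bar> * B * (\<Prod>i\<in>R. exp (- (c / 4 * (x i)\<^sup>2))))"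
    using c by (intro integrable_mult_right lborel_PiM.product_integrable_prod
        integrable_exp_minus_square) auto
  moreover have "(\<Prod>i\<in>R. exp (- (c / 4 * (x i)\<^sup>2))) = exp (- (c / 4 * (norm (restr_vec R x))\<^sup>2))" for x
  proof -
    have "(norm (restr_vec R x))\<^sup>2 = (\<Sum>i\<in>UNIV. if i \<in> R then (x i)\<^sup>2 else 0)"
      unfolding power2_norm_eq_inner inner_vec_def
      by (intro sum.cong) (auto simp: power2_eq_square)
    also have "\<dots> = (\<Sum>i\<in>R. (x i)\<^sup>2)" by (simp add: sum.If_cases)
    finally show ?thesis
      by (simp add: exp_sum sum_distrib_left sum_negf[symmetric] del: sum_negf)
  qed
  ultimately have "integrable (\<Pi>\<^sub>M i\<in>R. lborel)
      (\<lambda>x. \<bar>C\<bar> * B * exp (- (c / 4 * (norm (restr_vec R x))\<^sup>2)))"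
    by simp
  then show ?thesis
    by (rule Bochner_Integration.integrable_bound) (use bound in \<open>auto simp: abs_mult B_def\<close>)
qed

section \<open>Coordinatewise measure-preserving changes of variables\<close>

lemma distr_PiM_lborel:
  fixes f :: "'p::finite \<Rightarrow> real \<Rightarrow> real"
  assumes [measurable]: "\<And>i. f i \<in> borel_measurable borel"
    and f: "\<And>i. distr lborel borel (f i) = lborel"
  shows "distr (\<Pi>\<^sub>M i\<in>R. lborel) (\<Pi>\<^sub>M i\<in>R. lborel) (\<lambda>x. \<lambda>i\<in>R. f i (x i)) = (\<Pi>\<^sub>M i\<in>R. lborel)"
    (is "?D = ?M")
\<comment> \<open>A product measure is determined by its values on boxes, and the preimage of a box
  is again a box.\<close>
proof (rule lborel_PiM.PiM_eqI)
  fix A :: "'p \<Rightarrow> real set" assume A: "\<And>i. i \<in> R \<Longrightarrow> A i \<in> sets lborel"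
  have [measurable]: "(\<lambda>x. \<lambda>i\<in>R. f i (x i)) \<in> measurable ?M ?M" by measurable
  have "emeasure ?D (Pi\<^sub>E R A) = emeasure ?M ((\<lambda>x. \<lambda>i\<in>R. f i (x i)) -` Pi\<^sub>E R A \<inter> space ?M)"
    using A by (intro emeasure_distr) (auto intro!: sets_PiM_I_finite)
  also have "(\<lambda>x. \<lambda>i\<in>R. f i (x i)) -` Pi\<^sub>E R A \<inter> space ?M = (\<Pi>\<^sub>E i\<in>R. f i -` A i)"
    by (auto simp: space_PiM PiE_iff)
  also have "emeasure ?M (\<Pi>\<^sub>E i\<in>R. f i -` A i) = (\<Prod>i\<in>R. emeasure lborel (f i -` A i))"
    using A by (intro lborel_PiM.emeasure_PiM) (auto intro!: measurable_sets_borel[of "f _" borel])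
  also have "\<dots> = (\<Prod>i\<in>R. emeasure lborel (A i))"
  proof (intro prod.cong refl)
    fix i assume "i \<in> R"
    have "emeasure lborel (A i) = emeasure (distr lborel borel (f i)) (A i)" by (simp add: f)
    also have "\<dots> = emeasure lborel (f i -` A i)"
      using A[OF \<open>i \<in> R\<close>] by (subst emeasure_distr) auto
    finally show "emeasure lborel (f i -` A i) = emeasure lborel (A i)" by simp
  qed
  finally show "emeasure ?D (Pi\<^sub>E R A) = (\<Prod>i\<in>R. emeasure lborel (A i))" .
qed auto

text \<open>This is applied to the translation by a mean and to the reflection at the
  origin.\<close>

lemma integral_PiM_lborel_transform:
  fixes f :: "'p::finite \<Rightarrow> real \<Rightarrow> real" and \<phi> :: "('p \<Rightarrow> real) \<Rightarrow> real"
  assumes [measurable]: "\<And>i. f i \<in> borel_measurable borel"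
    and f: "\<And>i. distr lborel borel (f i) = lborel"
    and [measurable]: "\<phi> \<in> borel_measurable (\<Pi>\<^sub>M i\<in>R. lborel)"
  shows "(\<integral>x. \<phi> x \<partial>(\<Pi>\<^sub>M i\<in>R. lborel)) = (\<integral>x. \<phi> (\<lambda>i\<in>R. f i (x i)) \<partial>(\<Pi>\<^sub>M i\<in>R. lborel))"
  by (subst distr_PiM_lborel[OF assms(1) f, symmetric]) (auto intro!: integral_distr)

section \<open>The divergence as a function of the dose\<close>

lemma bounded_linear_matrix_vector [simp]: "bounded_linear ((*v) (M :: real^'n^'m))"
  by (simp add: linear_linear)

text \<open>Cauchy-Schwarz and the operator norm give the quadratic growth that
  \<open>integrable_PiM_gaussian\<close> asks for.\<close>

lemma quadratic_bound:
  fixes Q :: "real^'n^'n"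
  shows "\<bar>v \<bullet> (Q *v v)\<bar> \<le> onorm ((*v) Q) * (norm v)\<^sup>2"
proof -
  have "\<bar>v \<bullet> (Q *v v)\<bar> \<le> norm v * norm (Q *v v)" by (rule Cauchy_Schwarz_ineq2)
  also have "\<dots> \<le> norm v * (onorm ((*v) Q) * norm v)"
    by (intro mult_left_mono onorm) auto
  finally show ?thesis by (simp add: power2_eq_square mult_ac)
qed

text \<open>
  After translating by the mean of the first law, the log-likelihood ratio is a polynomial in the
  dose \<open>u\<close> whose linear coefficient is an odd function, so it integrates to zero.
\<close>

lemma KL_mvn:
  fixes R :: "'p::finite set" and m1 m2 :: "real^'p"
  assumes S: "pos_def S1" "pos_def S2"
  obtains c q where "0 \<le> q"
    "\<And>u. KL (mvn R (u *\<^sub>R m1) S1) (mvn R (u *\<^sub>R m2) S2) = c + q * u\<^sup>2"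
proof -
  let ?M = "\<Pi>\<^sub>M i\<in>R. lborel :: real measure"
  define Q1 where "Q1 = matrix_inv (block R S1)"
  define Q2 where "Q2 = matrix_inv (block R S2)"
  define N1 where "N1 = sqrt ((2 * pi) ^ card R * det (block R S1))"
  define N2 where "N2 = sqrt ((2 * pi) ^ card R * det (block R S2))"
  define v where "v = restr_vec R"
  define p1 where "p1 u x = exp (- (v (\<lambda>i. x i - (u *\<^sub>R m1) $ i) \<bullet>
      (Q1 *v v (\<lambda>i. x i - (u *\<^sub>R m1) $ i))) / 2) / N1" for u x
  define p2 where "p2 u x = exp (- (v (\<lambda>i. x i - (u *\<^sub>R m2) $ i) \<bullet>
      (Q2 *v v (\<lambda>i. x i - (u *\<^sub>R m2) $ i))) / 2) / N2" for u x
  \<comment> \<open>Here \<open>d\<close> is the difference of the means at dose 1, \<open>G\<close>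
    is the first density centred at the origin, and \<open>h0\<close>, \<open>h1\<close>,
    \<open>h2\<close> are the coefficients of the powers of \<open>u\<close> in the translated
    log-likelihood ratio. Both mixed terms are kept in \<open>h1\<close> because \<open>Q2\<close>
    is not known to be symmetric.\<close>
  define d where "d = v (($) (m2 - m1))"
  define G where "G w = exp (- (w \<bullet> (Q1 *v w)) / 2) / N1" for w
  define h0 where "h0 w = ln (N2 / N1) - w \<bullet> (Q1 *v w) / 2 + w \<bullet> (Q2 *v w) / 2" for w
  define h1 where "h1 w = - (d \<bullet> (Q2 *v w) + w \<bullet> (Q2 *v d)) / 2" for w
  define h2 where "h2 = d \<bullet> (Q2 *v d) / 2"
  have Q: "pos_def Q1" "pos_def Q2"
    using S by (auto simp: Q1_def Q2_def intro: pos_def_matrix_inv pos_def_block)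
  have N: "0 < N1" "0 < N2"
    using S by (auto simp: N1_def N2_def intro!: mult_pos_pos pos_def_det_pos pos_def_block)
  have [measurable]: "v \<in> borel_measurable ?M" unfolding v_def by measurable
  have quad [measurable]: "(\<lambda>w. w \<bullet> (Q *v w)) \<in> borel_measurable borel" for Q :: "real^'p^'p"
    by (intro borel_measurable_continuous_onI continuous_intros linear_continuous_on) auto
  have lin [measurable]: "(\<lambda>w. Q *v w) \<in> borel_measurable borel" for Q :: "real^'p^'p"
    by (intro borel_measurable_continuous_onI linear_continuous_on) auto
  have [measurable]: "h0 \<in> borel_measurable borel" "h1 \<in> borel_measurable borel"
    "G \<in> borel_measurable borel"
    unfolding h0_def h1_def G_def by measurable
  have vdiff: "v (\<lambda>i. x i - m i) = v x - v m" for x m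
    by (auto simp: v_def vec_eq_iff)
  have [measurable]: "p1 u \<in> borel_measurable ?M" "p2 u \<in> borel_measurable ?M" for u
    unfolding p1_def p2_def vdiff by measurable
  have mvn: "mvn R (u *\<^sub>R m1) S1 = density ?M (p1 u)" "mvn R (u *\<^sub>R m2) S2 = density ?M (p2 u)" for u
    unfolding mvn_def p1_def p2_def v_def inner_restr_vec Q1_def Q2_def N1_def N2_def by simp_all
  interpret M: sigma_finite_measure ?M by (rule lborel_PiM.sigma_finite) simp

  have "KL (mvn R (u *\<^sub>R m1) S1) (mvn R (u *\<^sub>R m2) S2)
      = (\<integral>x. G (v x) * h0 (v x) \<partial>?M) + (\<integral>x. G (v x) * h2 \<partial>?M) * u\<^sup>2" for u
  proof -
    have pos: "0 < p1 u x" "0 < p2 u x" for x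
      using N by (auto simp: p1_def p2_def)
    have "KL (mvn R (u *\<^sub>R m1) S1) (mvn R (u *\<^sub>R m2) S2)
        = (\<integral>x. p1 u x * log (exp 1) (p1 u x / p2 u x) \<partial>?M)"
      unfolding KL_def mvn using pos
      by (intro M.KL_density_density) (auto intro: less_imp_le simp: less_imp_neq[symmetric])
    also have "\<dots> = (\<integral>x. p1 u x * ln (p1 u x / p2 u x) \<partial>?M)"
      by (simp add: log_def)
    \<comment> \<open>Translating by \<open>u *\<^sub>R m1\<close> removes the dose from the first
      density and leaves it in the second only as the shift \<open>u *\<^sub>R d\<close>.\<close>
    also have "\<dots> = (\<integral>x. p1 u (\<lambda>i\<in>R. (u *\<^sub>R m1) $ i + x i) *
        ln (p1 u (\<lambda>i\<in>R. (u *\<^sub>R m1) $ i + x i) / p2 u (\<lambda>i\<in>R. (u *\<^sub>R m1) $ i + x i)) \<partial>?M)"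
      by (intro integral_PiM_lborel_transform lborel_distr_plus) measurable
    also have "\<dots> = (\<integral>x. G (v x) * h0 (v x) + u * (G (v x) * h1 (v x)) + u\<^sup>2 * (G (v x) * h2) \<partial>?M)"
    proof (intro Bochner_Integration.integral_cong refl)
      fix x
      let ?y = "\<lambda>i\<in>R. (u *\<^sub>R m1) $ i + x i"
      have 1: "v (\<lambda>i. ?y i - (u *\<^sub>R m1) $ i) = v x"
        and 2: "v (\<lambda>i. ?y i - (u *\<^sub>R m2) $ i) = v x - u *\<^sub>R d"
        by (auto simp: v_def d_def vec_eq_iff algebra_simps)
      have "ln (p1 u ?y / p2 u ?y) = ln (p1 u ?y) - ln (p2 u ?y)"
        using pos[of ?y] by (simp add: ln_div)
      also have "\<dots> = h0 (v x) + u * h1 (v x) + u\<^sup>2 * h2"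
      proof -
        have l1: "ln (p1 u ?y) = - (v x \<bullet> (Q1 *v v x)) / 2 - ln N1"
          unfolding p1_def 1 using N by (simp add: ln_div)
        have l2: "ln (p2 u ?y) = - ((v x - u *\<^sub>R d) \<bullet> (Q2 *v (v x - u *\<^sub>R d))) / 2 - ln N2"
          unfolding p2_def 2 using N by (simp add: ln_div)
        have l3: "(v x - u *\<^sub>R d) \<bullet> (Q2 *v (v x - u *\<^sub>R d)) = v x \<bullet> (Q2 *v v x)
            - u * (d \<bullet> (Q2 *v v x) + v x \<bullet> (Q2 *v d)) + u\<^sup>2 * (d \<bullet> (Q2 *v d))"
          by (simp add: matrix_vector_mult_diff_distrib inner_diff_left inner_diff_right
              matrix_vector_mult_scaleR power2_eq_square algebra_simps)
        have l4: "ln (N2 / N1) = ln N2 - ln N1"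
          using N by (simp add: ln_div)
        show ?thesis
          unfolding h0_def h1_def h2_def l1 l2 l3 l4 by (simp add: field_simps)
      qed
      finally have ratio: "ln (p1 u ?y / p2 u ?y) = h0 (v x) + u * h1 (v x) + u\<^sup>2 * h2" .
      have density: "p1 u ?y = G (v x)"
        unfolding p1_def 1 G_def ..
      show "p1 u ?y * ln (p1 u ?y / p2 u ?y)
          = G (v x) * h0 (v x) + u * (G (v x) * h1 (v x)) + u\<^sup>2 * (G (v x) * h2)"
        unfolding ratio unfolding density by (simp add: algebra_simps)
    qed
    also have "\<dots> = (\<integral>x. G (v x) * h0 (v x) \<partial>?M) + u * (\<integral>x. G (v x) * h1 (v x) \<partial>?M)
        + u\<^sup>2 * (\<integral>x. G (v x) * h2 \<partial>?M)"
    proof -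
      have int: "integrable ?M (\<lambda>x. G (v x) * h (v x))"
        if "h \<in> borel_measurable borel" "\<And>w. \<bar>h w\<bar> \<le> C * (1 + (norm w)\<^sup>2)" for h C
      proof -
        have "integrable ?M (\<lambda>x. 1 / N1 * (exp (- (v x \<bullet> (Q1 *v v x)) / 2) * h (v x)))"
          unfolding v_def by (intro integrable_mult_right integrable_PiM_gaussian[OF Q(1) that])
        then show ?thesis by (simp add: G_def)
      qed
      have i0: "integrable ?M (\<lambda>x. G (v x) * h0 (v x))"
      proof (rule int)
        fix w :: "real^'p"
        let ?o1 = "onorm ((*v) Q1)" and ?o2 = "onorm ((*v) Q2)"
        have o: "0 \<le> ?o1" "0 \<le> ?o2" by (auto intro: onorm_pos_le)
        have "\<bar>h0 w\<bar> \<le> \<bar>ln (N2 / N1)\<bar> + ?o1 * (norm w)\<^sup>2 + ?o2 * (norm w)\<^sup>2"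
          using quadratic_bound[of w Q1] quadratic_bound[of w Q2] unfolding h0_def by linarith
        also have "\<dots> \<le> (\<bar>ln (N2 / N1)\<bar> + ?o1 + ?o2) * (1 + (norm w)\<^sup>2)"
          using o by (simp add: algebra_simps)
        finally show "\<bar>h0 w\<bar> \<le> (\<bar>ln (N2 / N1)\<bar> + ?o1 + ?o2) * (1 + (norm w)\<^sup>2)" .
      qed measurable
      have i1: "integrable ?M (\<lambda>x. G (v x) * h1 (v x))"
      proof (rule int)
        fix w :: "real^'p"
        let ?o2 = "onorm ((*v) Q2)"
        have o: "0 \<le> ?o2" by (auto intro: onorm_pos_le)
        have "\<bar>d \<bullet> (Q2 *v w)\<bar> \<le> norm d * (?o2 * norm w)"
          by (rule order_trans[OF Cauchy_Schwarz_ineq2]) (auto intro!: mult_left_mono onorm)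
        moreover have "\<bar>w \<bullet> (Q2 *v d)\<bar> \<le> norm w * (?o2 * norm d)"
          by (rule order_trans[OF Cauchy_Schwarz_ineq2]) (auto intro!: mult_left_mono onorm)
        ultimately have "\<bar>h1 w\<bar> \<le> norm d * ?o2 * norm w"
          unfolding h1_def by (simp add: mult_ac)
        \<comment> \<open>The linear growth of \<open>h1\<close> is weakened to quadratic growth to
          fit the integrability criterion.\<close>
        also have "norm w \<le> 1 + (norm w)\<^sup>2"
        proof -
          have "2 * norm w \<le> 1 + (norm w)\<^sup>2"
            using sum_squares_bound[of 1 "norm w"] by simp
          then show ?thesis using norm_ge_zero[of w] by linarith
        qed
        finally show "\<bar>h1 w\<bar> \<le> norm d * ?o2 * (1 + (norm w)\<^sup>2)"
          using o by (simp add: mult_left_mono)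
      qed measurable
      have i2: "integrable ?M (\<lambda>x. G (v x) * h2)"
        by (rule int[of "\<lambda>_. h2" "\<bar>h2\<bar>"]) (auto simp: algebra_simps)
      from i0 i1 i2 show ?thesis by simp
    qed
    \<comment> \<open>The reflection preserves Lebesgue measure, \<open>G\<close> is even and
      \<open>h1\<close> is odd, so the integral equals its own negative.\<close>
    also have "(\<integral>x. G (v x) * h1 (v x) \<partial>?M) = 0"
    proof -
      have "(\<integral>x. G (v x) * h1 (v x) \<partial>?M)
          = (\<integral>x. G (v (\<lambda>i\<in>R. - x i)) * h1 (v (\<lambda>i\<in>R. - x i)) \<partial>?M)"
        by (intro integral_PiM_lborel_transform lborel_distr_uminus) measurable
      also have "\<dots> = (\<integral>x. - (G (v x) * h1 (v x)) \<partial>?M)"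
      proof (intro Bochner_Integration.integral_cong refl)
        fix x
        have "v (\<lambda>i\<in>R. - x i) = - v x" by (auto simp: v_def vec_eq_iff)
        moreover have neg: "Q *v (- w) = - (Q *v w)" for Q :: "real^'p^'p" and w
          by (simp add: linear_neg)
        moreover have "G (- w) = G w" for w
          by (simp add: G_def neg)
        moreover have "h1 (- w) = - h1 w" for w
          by (simp add: h1_def neg diff_divide_distrib add_divide_distrib)
        ultimately show "G (v (\<lambda>i\<in>R. - x i)) * h1 (v (\<lambda>i\<in>R. - x i)) = - (G (v x) * h1 (v x))"
          by simp
      qed
      finally show ?thesis by simp
    qed
    finally show ?thesis by (simp add: mult.commute)
  qed
  \<comment> \<open>This integral is the coefficient \<open>q\<close>; its sign comes from positive
    definiteness of \<open>Q2\<close>, with \<open>d = 0\<close> treated separately.\<close>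
  moreover have "0 \<le> (\<integral>x. G (v x) * h2 \<partial>?M)"
  proof (intro integral_nonneg_AE AE_I2 mult_nonneg_nonneg)
    show "0 \<le> h2" using Q(2) unfolding pos_def_def h2_def by (cases "d = 0") (auto intro: less_imp_le)
  qed (use N in \<open>auto simp: G_def\<close>)
  ultimately show ?thesis using that by blast
qed

text \<open>For fixed \<open>j\<close> and fixed models the divergence is
  \<open>c + q * x\<^sup>2\<close> with \<open>q \<ge> 0\<close> and both coefficients independent
  of the dose, so it grows with the modulus of the dose.\<close>

lemma KL_act_dist_Do_mono:
  fixes \<theta> \<kappa> :: "'p::finite model"
  assumes "0 < \<sigma>min" and \<theta>: "\<theta> \<in> models \<beta>min Amax \<sigma>min \<sigma>max"
    and \<kappa>: "\<kappa> \<in> models \<beta>min Amax \<sigma>min \<sigma>max" and u: "\<bar>u\<bar> \<le> \<bar>t\<bar>"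
  shows "KL (act_dist \<theta> (Do j u)) (act_dist \<kappa> (Do j u))
    \<le> KL (act_dist \<theta> (Do j t)) (act_dist \<kappa> (Do j t))"
proof -
  define R where "R = UNIV - {j}"
  define K where "K \<eta> = matrix_inv (block R (mat 1 - coef \<eta>))" for \<eta> :: "'p model"
  define S where "S \<eta> = K \<eta> ** block R (noise \<eta>) ** transpose (K \<eta>)" for \<eta> :: "'p model"
  define m where "m \<eta> = K \<eta> *v column j (coef \<eta>)" for \<eta> :: "'p model"
  \<comment> \<open>The covariance is congruent to a diagonal matrix with positive entries, through
    a matrix that acyclicity makes invertible.\<close>
  have pd: "pos_def (S \<eta>)" if "\<eta> \<in> models \<beta>min Amax \<sigma>min \<sigma>max" for \<eta> :: "'p model"
  proof -
    from that obtain \<sigma> :: "'p \<Rightarrow> real" where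
      noise: "noise \<eta> = (\<chi> j k. if j = k then (\<sigma> j)\<^sup>2 else 0)" "\<And>j. \<sigma>min\<^sup>2 \<le> (\<sigma> j)\<^sup>2"
      by (auto simp: models_def)
    have "0 < (\<sigma> j)\<^sup>2" for j
      using noise(2)[of j] \<open>0 < \<sigma>min\<close> by (smt (verit) zero_less_power)
    then have "pos_def (block R (noise \<eta>))"
      unfolding noise(1) by (intro pos_def_block pos_def_diag)
    moreover have "invertible (K \<eta>)"
      unfolding K_def using that
      by (intro invertible_matrix_inv invertible_block_dag[of "dag \<eta>"]) (auto simp: models_def)
    ultimately show ?thesis
      unfolding S_def by (rule pos_def_congruence)
  qed
  have act: "act_dist \<eta> (Do j x) = mvn R (x *\<^sub>R m \<eta>) (S \<eta>)" for \<eta> x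
    by (simp add: Let_def R_def K_def S_def m_def matrix_vector_mult_scaleR)
  obtain c q where "0 \<le> q" and
    "\<And>x. KL (act_dist \<theta> (Do j x)) (act_dist \<kappa> (Do j x)) = c + q * x\<^sup>2"
    using KL_mvn[OF pd[OF \<theta>] pd[OF \<kappa>], of R "m \<theta>" "m \<kappa>"] unfolding act by metis
  then show ?thesis
    using u by (auto intro!: mult_left_mono simp: abs_le_square_iff)
qed

section \<open>Upper semicontinuity and compactness\<close>

text \<open>If every point of \<open>W\<close> were beaten by another, the open sets on which some
  \<open>f k\<close> lies below the value of a competitor \<open>v\<close> would cover
  \<open>W\<close>. In a finite subcover the best competitor lies in one of the sets, so it is
  beaten by another competitor of the subcover, a contradiction.\<close>

lemma compact_attains_sup_Inf:
  fixes f :: "'k \<Rightarrow> 'a::topological_space \<Rightarrow> ennreal"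
  assumes "compact W" "W \<noteq> {}" and cont: "\<And>k. k \<in> K \<Longrightarrow> continuous_on UNIV (f k)"
  obtains w where "w \<in> W" "\<And>v. v \<in> W \<Longrightarrow> (INF k\<in>K. f k v) \<le> (INF k\<in>K. f k w)"
proof (rule ccontr)
  note obtained = that
  let ?F = "\<lambda>v. INF k\<in>K. f k v"
  assume "\<not> thesis"
  then have no: "\<exists>v\<in>W. ?F w < ?F v" if "w \<in> W" for w
    using obtained that by (metis not_le)
  let ?U = "\<lambda>(k, v). {x. f k x < ?F v}"
  have "open (?U c)" if "c \<in> K \<times> W" for c
    using that cont by (auto intro!: open_Collect_less)
  moreover have "W \<subseteq> (\<Union>c\<in>K \<times> W. ?U c)"
  proof
    fix w assume "w \<in> W"
    with no obtain v where "v \<in> W" "?F w < ?F v" by blast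
    then show "w \<in> (\<Union>c\<in>K \<times> W. ?U c)" by (auto simp: INF_less_iff)
  qed
  ultimately obtain C where C: "C \<subseteq> K \<times> W" "finite C" "W \<subseteq> (\<Union>c\<in>C. ?U c)"
    using compactE_image[OF \<open>compact W\<close>, of "K \<times> W" ?U] by metis
  with \<open>W \<noteq> {}\<close> have "C \<noteq> {}" by auto
  with C(2) have "Max (?F ` snd ` C) \<in> ?F ` snd ` C"
    by (intro Max_in) auto
  then obtain k v where kv: "(k, v) \<in> C" "Max (?F ` snd ` C) = ?F v"
    by auto
  then have "v \<in> W" using C by auto
  then obtain k' v' where c: "(k', v') \<in> C" "f k' v < ?F v'"
    using C(3) by fastforce
  then have "?F v \<le> f k' v" using C(1) by (auto intro: INF_lower)
  also note c(2)
  also have "?F v' \<le> Max (?F ` snd ` C)"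
    using c(1) C(2) by (intro Max_ge) (auto intro: rev_image_eqI)
  finally show False using kv(2) by simp
qed

section \<open>Reduction to finitely many actions\<close>

lemma space_action_space [simp]: "space (action_space U1 U2) = actions U1 U2"
  unfolding action_space_def by (intro space_measure_of) auto

lemma sets_action_spaceI:
  assumes "S \<subseteq> actions U1 U2" "\<And>j. \<exists>T. open T \<and> {u. Do j u \<in> S} = {U1 j..U2 j} \<inter> T"
  shows "S \<in> sets (action_space U1 U2)"
  unfolding action_space_def using assms
  by (subst sets_measure_of) (auto intro!: sigma_sets.Basic simp: openin_open)

text \<open>An arm forgets the dose, and \<open>None\<close> is passive observation. Since the
  option type is finite, it can index the coordinates of a real vector.\<close>

fun arm :: "'p action \<Rightarrow> 'p option" where
  "arm Obs = None"
| "arm (Do j u) = Some j"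

lemma sets_arm: "arm -` {a} \<inter> actions U1 U2 \<in> sets (action_space U1 U2)"
proof (rule sets_action_spaceI)
  fix j
  have "{u. Do j u \<in> arm -` {a} \<inter> actions U1 U2} = {U1 j..U2 j} \<inter> (if a = Some j then UNIV else {})"
    by (auto simp: actions_def)
  then show "\<exists>T. open T \<and> {u. Do j u \<in> arm -` {a} \<inter> actions U1 U2} = {U1 j..U2 j} \<inter> T"
    by (metis open_UNIV open_empty)
qed auto

text \<open>The complement is one of the generating open sets. This serves for finite sets of
  actions.\<close>

lemma sets_action_space_closed:
  assumes "S \<subseteq> actions U1 U2" "\<And>j. closed {u. Do j u \<in> S}"
  shows "S \<in> sets (action_space U1 U2)"
proof -
  have "actions U1 U2 - S \<in> sets (action_space U1 U2)"
  proof (rule sets_action_spaceI)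
    fix j
    have "{u. Do j u \<in> actions U1 U2 - S} = {U1 j..U2 j} \<inter> - {u. Do j u \<in> S}"
      by (auto simp: actions_def)
    then show "\<exists>T. open T \<and> {u. Do j u \<in> actions U1 U2 - S} = {U1 j..U2 j} \<inter> T"
      using assms(2) by blast
  qed auto
  then have "space (action_space U1 U2) - (actions U1 U2 - S) \<in> sets (action_space U1 U2)"
    by (rule sets.compl_sets)
  also have "space (action_space U1 U2) - (actions U1 U2 - S) = S"
    using assms(1) by auto
  finally show ?thesis .
qed

lemma sets_endpoint_actions:
  assumes "\<And>j. U1 j \<le> U2 j"
  shows "endpoint_actions U1 U2 \<in> sets (action_space U1 U2)"
proof (rule sets_action_space_closed)
  show "endpoint_actions U1 U2 \<subseteq> actions U1 U2"
    using assms by (auto simp: actions_def endpoint_actions_def)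
  show "closed {u. Do j u \<in> endpoint_actions U1 U2}" for j
  proof -
    have "{u. Do j u \<in> endpoint_actions U1 U2} = {U1 j, U2 j}"
      by (auto simp: endpoint_actions_def)
    then show ?thesis by simp
  qed
qed

text \<open>The arms cut the action space into finitely many measurable cells, and the integrand is
  constant on each.\<close>

lemma nn_integral_arm:
  fixes h :: "'p::finite option \<Rightarrow> ennreal"
  assumes w: "w \<in> designs U1 U2"
  shows "(\<integral>\<^sup>+a. h (arm a) \<partial>w) = (\<Sum>b\<in>UNIV. h b * emeasure w (arm -` {b} \<inter> space w))"
proof -
  have sets: "sets w = sets (action_space U1 U2)" and space: "space w = actions U1 U2"
    using w sets_eq_imp_space_eq[of w "action_space U1 U2"] by (auto simp: designs_def)
  have m: "arm -` {b} \<inter> space w \<in> sets w" for b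
    unfolding sets space by (rule sets_arm)
  have "(\<integral>\<^sup>+a. h (arm a) \<partial>w) = (\<integral>\<^sup>+a. (\<Sum>b\<in>UNIV. h b * indicator (arm -` {b} \<inter> space w) a) \<partial>w)"
    by (intro nn_integral_cong) (auto simp: indicator_def if_distrib cong: if_cong)
  also have "\<dots> = (\<Sum>b\<in>UNIV. h b * emeasure w (arm -` {b} \<inter> space w))"
    using m by (subst nn_integral_sum) (auto simp: nn_integral_cmult_indicator)
  finally show ?thesis .
qed

section \<open>The simplex of arm weights and the designs realising it\<close>

definition weights :: "(real^'n::finite) set" where
  "weights = {v. (\<forall>i. 0 \<le> v $ i) \<and> (\<Sum>i\<in>UNIV. v $ i) = 1}"

lemma compact_weights: "compact weights"
  unfolding compact_eq_bounded_closed
proof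
  have "norm v \<le> 1" if "v \<in> weights" for v :: "real^'a"
    using norm_le_l1_cart[of v] that by (simp add: weights_def)
  then show "bounded (weights :: (real^'a) set)" by (auto intro: boundedI)
  show "closed (weights :: (real^'a) set)"
    unfolding weights_def
    by (intro closed_Collect_conj closed_Collect_all closed_Collect_le closed_Collect_eq continuous_intros)
qed

definition arm_weights :: "'p::finite action measure \<Rightarrow> real^'p option" where
  "arm_weights w = (\<chi> b. measure w (arm -` {b} \<inter> space w))"

lemma emeasure_arm:
  assumes "w \<in> designs U1 U2"
  shows "emeasure w (arm -` {b} \<inter> space w) = ennreal (arm_weights w $ b)"
proof -
  interpret prob_space w using assms by (simp add: designs_def)
  show ?thesis by (simp add: arm_weights_def emeasure_eq_measure)
qed

lemma arm_weights_in_weights: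
  fixes w :: "'p::finite action measure"
  assumes w: "w \<in> designs U1 U2"
  shows "arm_weights w \<in> weights"
proof -
  interpret prob_space w using w by (simp add: designs_def)
  have "ennreal (\<Sum>b\<in>UNIV. arm_weights w $ b) = (\<Sum>b\<in>UNIV. ennreal (arm_weights w $ b))"
    by (intro sum_ennreal[symmetric]) (simp add: arm_weights_def)
  also have "\<dots> = (\<integral>\<^sup>+a. 1 \<partial>w)"
    using nn_integral_arm[OF w, of "\<lambda>_. 1"] by (simp add: emeasure_arm[OF w])
  also have "\<dots> = ennreal 1" by (simp add: emeasure_space_1)
  finally have "(\<Sum>b\<in>UNIV. arm_weights w $ b) = 1"
    by (subst (asm) ennreal_inj) (auto simp: arm_weights_def sum_nonneg)
  then show ?thesis by (simp add: weights_def arm_weights_def)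
qed

text \<open>The design is the image under \<open>e\<close> of the discrete measure \<open>v\<close>
  on arms. It is concentrated on \<open>range e\<close>, where \<open>e (arm a) = a\<close>, which
  gives the last conclusion.\<close>

lemma design_of_weights:
  fixes v :: "real^'p::finite option" and e :: "'p option \<Rightarrow> 'p action"
  assumes v: "v \<in> weights" and e: "\<And>b. arm (e b) = b" "\<And>b. e b \<in> actions U1 U2"
  obtains w where "w \<in> designs U1 U2" "arm_weights w = v"
    "\<And>S. S \<in> sets w \<Longrightarrow> range e \<subseteq> S \<Longrightarrow> emeasure w S = 1"
    "\<And>f :: 'p action \<Rightarrow> ennreal. (\<integral>\<^sup>+a. f (e (arm a)) \<partial>w) = (\<integral>\<^sup>+a. f a \<partial>w)"
proof -
  let ?P = "point_measure UNIV (\<lambda>b. ennreal (v $ b))"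
  define w where "w = distr ?P (action_space U1 U2) e"
  have [measurable]: "e \<in> measurable ?P (action_space U1 U2)"
    using e(2) by simp
  have P: "emeasure ?P X = ennreal (\<Sum>b\<in>X. v $ b)" for X
    using v by (subst emeasure_point_measure_finite) (auto simp: weights_def sum_ennreal)
  interpret P: prob_space ?P
    using v by (intro prob_spaceI) (simp add: P space_point_measure weights_def)
  have sets: "sets w = sets (action_space U1 U2)" and space: "space w = actions U1 U2"
    by (auto simp: w_def)
  interpret w: prob_space w
    unfolding w_def by (rule P.prob_space_distr) measurable
  have emeasure: "emeasure w S = emeasure ?P (e -` S)" if "S \<in> sets w" for S
    using that sets unfolding w_def by (subst emeasure_distr) (simp_all add: space_point_measure e(2))
  have full: "emeasure w S = 1" if "S \<in> sets w" "range e \<subseteq> S" for S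
  proof -
    have "e -` S = UNIV" using that(2) by auto
    then show ?thesis
      using emeasure[OF that(1)] v by (simp add: P weights_def)
  qed
  show ?thesis
  proof (rule that)
    show "w \<in> designs U1 U2"
      unfolding designs_def using sets w.prob_space_axioms by simp
    show "arm_weights w = v"
    proof -
      have "measure w (arm -` {b} \<inter> space w) = v $ b" for b
      proof -
        have "e -` (arm -` {b} \<inter> space w) = {b}" using e by (auto simp: space)
        then have "emeasure w (arm -` {b} \<inter> space w) = ennreal (v $ b)"
          using sets_arm[of b U1 U2] by (subst emeasure) (auto simp: sets space P)
        then show ?thesis using v by (simp add: measure_def weights_def)
      qed
      then show ?thesis by (simp add: arm_weights_def vec_eq_iff)
    qed
    show "(\<integral>\<^sup>+a. f (e (arm a)) \<partial>w) = (\<integral>\<^sup>+a. f a \<partial>w)" for f :: "'p action \<Rightarrow> ennreal"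
    proof (rule nn_integral_cong_AE)
      have "range e \<in> sets w"
        unfolding sets
      proof (rule sets_action_space_closed)
        show "range e \<subseteq> actions U1 U2" using e(2) by auto
        fix j
        have "{u. Do j u \<in> range e} \<subseteq> {u. Do j u = e (Some j)}"
          using e(1) by (auto simp: image_iff) (metis arm.simps(2))
        \<comment> \<open>Injectivity of \<open>Do j\<close> leaves at most one dose per target, so
          the fibre is finite and hence closed.\<close>
        also have "\<dots> \<subseteq> {THE u. Do j u = e (Some j)}" 
          by (auto intro!: the_equality[symmetric]) (metis action.inject)
        finally have "finite {u. Do j u \<in> range e}"
          by (rule finite_subset) simp
        then show "closed {u. Do j u \<in> range e}" by (rule finite_imp_closed)
      qed
      then have "AE a in w. a \<in> range e"
        using full[of "range e"] by (intro w.AE_prob_1) (simp add: measure_def)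
      then show "AE a in w. f (e (arm a)) = f a"
        by eventually_elim (auto simp: e(1))
    qed
  qed (rule full)
qed

text \<open>Replacing each action by the representative \<open>e\<close> of its arm raises all
  payoffs \<open>F k\<close> simultaneously. Only the arm weights then matter, and the objective
  becomes an infimum of linear functions on a compact simplex.\<close>

lemma maximin_design:
  fixes F :: "'k \<Rightarrow> 'p::finite action \<Rightarrow> ennreal" and e :: "'p option \<Rightarrow> 'p action"
  assumes e: "\<And>b. arm (e b) = b" "\<And>b. e b \<in> actions U1 U2"
    and dom: "\<And>k a. k \<in> K \<Longrightarrow> a \<in> actions U1 U2 \<Longrightarrow> F k a \<le> F k (e (arm a))"
    and fin: "\<And>k a. k \<in> K \<Longrightarrow> F k a < \<infinity>"
  obtains w where "w \<in> designs U1 U2"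
    "\<And>S. S \<in> sets w \<Longrightarrow> range e \<subseteq> S \<Longrightarrow> emeasure w S = 1"
    "\<And>w'. w' \<in> designs U1 U2 \<Longrightarrow> (INF k\<in>K. \<integral>\<^sup>+a. F k a \<partial>w') \<le> (INF k\<in>K. \<integral>\<^sup>+a. F k a \<partial>w)"
proof -
  define H where "H k v = (\<Sum>b\<in>UNIV. F k (e b) * ennreal (v $ b))" for k and v :: "real^'p option"
  have H: "(\<integral>\<^sup>+a. F k (e (arm a)) \<partial>w) = H k (arm_weights w)" if "w \<in> designs U1 U2" for k w
    using nn_integral_arm[OF that, of "\<lambda>b. F k (e b)"] by (simp add: H_def emeasure_arm[OF that])
  have "continuous_on UNIV (H k)" if "k \<in> K" for k
  proof -
    have "continuous_on UNIV (\<lambda>v. F k (e b) * ennreal (v $ b))" for b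
    proof -
      \<comment> \<open>Finite payoffs are what makes this continuous: an infinite factor would
        produce a jump at weight 0.\<close>
      have "F k (e b) * ennreal (v $ b) = ennreal (enn2real (F k (e b)) * v $ b)" for v :: "real^'p option"
        using fin[OF that, of "e b"] by (simp add: ennreal_mult')
      then show ?thesis by (simp add: continuous_on_ennreal continuous_intros)
    qed
    then show ?thesis
      unfolding H_def by (intro continuous_on_sum)
  qed
  \<comment> \<open>The vertex with all mass on passive observation shows that the simplex is
    nonempty.\<close>
  moreover have "axis None 1 \<in> (weights :: (real^'p option) set)"
    by (auto simp: weights_def axis_def if_distrib cong: if_cong)
  ultimately obtain v where v: "v \<in> weights" "\<And>v'. v' \<in> weights \<Longrightarrow> (INF k\<in>K. H k v') \<le> (INF k\<in>K. H k v)"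
    using compact_attains_sup_Inf[OF compact_weights, of K H] by blast
  obtain w where w: "w \<in> designs U1 U2" "arm_weights w = v"
    "\<And>S. S \<in> sets w \<Longrightarrow> range e \<subseteq> S \<Longrightarrow> emeasure w S = 1"
    "\<And>f :: 'p action \<Rightarrow> ennreal. (\<integral>\<^sup>+a. f (e (arm a)) \<partial>w) = (\<integral>\<^sup>+a. f a \<partial>w)"
    using design_of_weights[OF v(1) e] by blast
  show ?thesis
  proof (rule that[OF w(1) w(3)])
    fix w' assume w': "w' \<in> designs U1 U2"
    then have "space w' = actions U1 U2"
      using sets_eq_imp_space_eq[of w' "action_space U1 U2"] by (auto simp: designs_def)
    then have "(INF k\<in>K. \<integral>\<^sup>+a. F k a \<partial>w') \<le> (INF k\<in>K. H k (arm_weights w'))"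
      unfolding H[OF w', symmetric] by (intro INF_superset_mono nn_integral_mono) (auto simp: dom)
    also have "\<dots> \<le> (INF k\<in>K. H k v)"
      by (rule v(2)[OF arm_weights_in_weights[OF w']])
    also have "\<dots> = (INF k\<in>K. \<integral>\<^sup>+a. F k a \<partial>w)"
    proof -
      have "H k v = (\<integral>\<^sup>+a. F k a \<partial>w)" for k
        unfolding w(4)[of "F k", symmetric] H[OF w(1)] w(2) ..
      then show ?thesis by simp
    qed
    finally show "(INF k\<in>K. \<integral>\<^sup>+a. F k a \<partial>w') \<le> (INF k\<in>K. \<integral>\<^sup>+a. F k a \<partial>w)" .
  qed
qed

theorem proposition4p1:
  fixes U1 U2 :: "'p::finite \<Rightarrow> real"
    and \<beta>min Amax \<sigma>min \<sigma>max Cmax r :: real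
    and \<theta> :: "'p model"
  assumes "\<beta>min > 0" "Amax > 0" "\<sigma>min > 0" "\<sigma>max > 0" "Cmax > 0"
    and "\<And>j. U1 j \<le> U2 j"
    and "\<And>j u. u \<in> {U1 j..U2 j} \<Longrightarrow> \<bar>u\<bar> \<le> Cmax"
    and "\<theta> \<in> models \<beta>min Amax \<sigma>min \<sigma>max"
    and "r > 0"
  shows "\<exists>w \<in> designs U1 U2.
           emeasure w (endpoint_actions U1 U2) = 1 \<and>
           worst_case \<beta>min Amax \<sigma>min \<sigma>max r \<theta> w = C_opt U1 U2 \<beta>min Amax \<sigma>min \<sigma>max r \<theta>"
proof -
  let ?M = "models \<beta>min Amax \<sigma>min \<sigma>max" and ?K = "Alt \<beta>min Amax \<sigma>min \<sigma>max r \<theta>"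
  \<comment> \<open>The modulus on an interval is largest at an endpoint. The choice depends on the
    interval only, so one selector \<open>e\<close> dominates against every alternative at
    once.\<close>
  define t where "t j = (if \<bar>U1 j\<bar> \<le> \<bar>U2 j\<bar> then U2 j else U1 j)" for j
  define e where "e b = (case b of None \<Rightarrow> Obs | Some j \<Rightarrow> Do j (t j))" for b
  let ?F = "\<lambda>\<kappa> a. ennreal (KL (act_dist \<theta> a) (act_dist \<kappa> a))"
  have e: "arm (e b) = b" "e b \<in> endpoint_actions U1 U2" for b
    by (auto simp: e_def t_def endpoint_actions_def split: option.split)
  have endpoints: "endpoint_actions U1 U2 \<subseteq> actions U1 U2"
    using assms(6) by (auto simp: endpoint_actions_def actions_def)
  have dom: "?F \<kappa> a \<le> ?F \<kappa> (e (arm a))" if "\<kappa> \<in> ?K" "a \<in> actions U1 U2" for \<kappa> a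
  proof (cases a)
    case (Do j u)
    with that have "U1 j \<le> u" "u \<le> U2 j" by (auto simp: actions_def)
    then have "\<bar>u\<bar> \<le> \<bar>t j\<bar>" by (auto simp: t_def)
    then show ?thesis
      using KL_act_dist_Do_mono[OF assms(3,8)] that(1) Do
      by (auto simp: e_def Alt_def intro!: ennreal_leI simp del: act_dist.simps)
  qed (simp add: e_def)
  have fin: "?F \<kappa> a < \<infinity>" for \<kappa> a
    by simp
  obtain w where w: "w \<in> designs U1 U2"
    "\<And>S. S \<in> sets w \<Longrightarrow> range e \<subseteq> S \<Longrightarrow> emeasure w S = 1"
    "\<And>w'. w' \<in> designs U1 U2 \<Longrightarrow> (INF \<kappa>\<in>?K. \<integral>\<^sup>+a. ?F \<kappa> a \<partial>w') \<le> (INF \<kappa>\<in>?K. \<integral>\<^sup>+a. ?F \<kappa> a \<partial>w)"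
    using maximin_design[of e U1 U2 ?K ?F, OF e(1) subsetD[OF endpoints e(2)] dom fin] by blast
  have "endpoint_actions U1 U2 \<in> sets w"
    using w(1) sets_endpoint_actions[of U1 U2] assms(6) by (simp add: designs_def)
  then have "emeasure w (endpoint_actions U1 U2) = 1"
    using w(2) e(2) by blast
  \<comment> \<open>As a member of \<open>designs\<close>, \<open>w\<close> stays below the
    supremum; by its optimality it bounds every other design from above.\<close>
  moreover have "worst_case \<beta>min Amax \<sigma>min \<sigma>max r \<theta> w = C_opt U1 U2 \<beta>min Amax \<sigma>min \<sigma>max r \<theta>"
    unfolding C_opt_def using w(1,3)
    by (intro antisym SUP_upper SUP_least) (auto simp: worst_case_def simp del: act_dist.simps)
  ultimately show ?thesis using w(1) by blast
qed

end
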